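(* Let $(X,d)$ be a geodetic metric space that has no $4$-cut and satisfies $h_X<\infty$, and let $k>0$ be an integer. Then the following hold. (1) $\nu_k(X)=k\cdot h_X$. (2) $H_k^{\Sigma,\nu_k(X)}(X)\neq 0$ if and only if there exist $a,b\in X$ with $a\neq b$ such that $d(a,b)=h_X$ and $I_X(a,b)=\emptyset$.
   Context: Let $(X,d)$ be a metric space. For $x,y,z\in X$ write $x\preceq y\preceq z$ if $d(x,y)+d(y,z)=d(x,z)$, and $x\prec y\prec z$ if moreover $x\neq y$ and $y\neq z$. A tuple $\boldsymbol{x}=(x_0,\dots,x_n)\in X^{n+1}$ is a proper chain of degree $n$ if $x_{i-1}\neq x_i$ for all $i=1,\dots,n$; its length is $|\boldsymbol{x}|=\sum_{i=1}^n d(x_{i-1},x_i)$. $P_n(X)$ is the set of proper chains of degree $n$, and $P_n^{\ell}(X)$ is the set of those of length $\ell$. A $4$-cut of $X$ is $(x_0,x_1,x_2,x_3)\in P_3(X)$ with $x_0\prec x_1\prec x_2$, $x_1\prec x_2\prec x_3$ and $d(x_0,x_3)<|(x_0,x_1,x_2,x_3)|$. For $a,b\in X$, $I_X(a,b):=\{x\in X\mid a\prec x\prec b\}$ is a poset with $x\le y$ iff $a\neq x$ and $d(a,x)+d(x,y)=d(a,y)$. $X$ is geodetic if $I_X(a,b)$ is totally ordered (or empty) for all $a,b\in X$. The magnitude chain complex in grading $\ell\in\mathbb{R}_{\ge0}$ is $B_n^{\ell}(X)=\bigoplus_{\boldsymbol{x}\in P_n^{\ell}(X)}\mathbb{Z}\cdot\langle\boldsymbol{x}\rangle$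 with boundary $\partial_n=\sum_i(-1)^i\partial_{n,i}$, where $\partial_{n,i}\langle x_0,\dots,x_n\rangle=\langle x_0,\dots,\widehat{x_i},\dots,x_n\rangle$ if $1\le i\le n-1$ and $x_{i-1}\prec x_i\prec x_{i+1}$, and $0$ otherwise. Its homology is the magnitude homology $H_n^{\Sigma,\ell}(X)$. $h_X:=\sup\{d(a,b)\mid a,b\in X,\ a\neq b,\ I_X(a,b)=\emptyset\}$, with $h_X=0$ if there is no such pair. For an integer $k>0$, the vanishing threshold is $\nu_k(X):=\sup\{\ell\mid\ell>0,\ H_k^{\Sigma,\ell}(X)\neq0\}$ if $H_k^{\Sigma,\ell}(X)\neq0$ for some $\ell>0$, and $\nu_k(X):=0$ otherwise. *)

theory Defs
  imports
    "HOL-Library.Extended_Real"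
    "HOL-Analysis.Abstract_Metric_Spaces"
    "HOL-Algebra.Free_Abelian_Groups"
begin

text \<open>
  A metric space is a carrier \<open>M\<close> with a distance \<open>d\<close> satisfying \<^locale>\<open>Metric_space\<close>,
  so the empty space is allowed.
\<close>

definition weakly_between :: "('a \<Rightarrow> 'a \<Rightarrow> real) \<Rightarrow> 'a \<Rightarrow> 'a \<Rightarrow> 'a \<Rightarrow> bool" where
  "weakly_between d x y z \<longleftrightarrow> d x y + d y z = d x z"

definition strictly_between :: "('a \<Rightarrow> 'a \<Rightarrow> real) \<Rightarrow> 'a \<Rightarrow> 'a \<Rightarrow> 'a \<Rightarrow> bool" where
  "strictly_between d x y z \<longleftrightarrow> weakly_between d x y z \<and> x \<noteq> y \<and> y \<noteq> z"

text \<open>A chain of degree \<open>n\<close> is the list of its \<open>n + 1\<close> points \<open>x\<^sub>0, \<dots>, x\<^sub>n\<close>.\<close>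

definition proper_chains :: "'a set \<Rightarrow> nat \<Rightarrow> 'a list set" where
  "proper_chains M n =
     {xs. length xs = Suc n \<and> set xs \<subseteq> M \<and> (\<forall>i\<in>{1..n}. xs ! (i - 1) \<noteq> xs ! i)}"

definition chain_length :: "('a \<Rightarrow> 'a \<Rightarrow> real) \<Rightarrow> 'a list \<Rightarrow> real" where
  "chain_length d xs = (\<Sum>i = 1..<length xs. d (xs ! (i - 1)) (xs ! i))"

definition proper_chains_len ::
  "'a set \<Rightarrow> ('a \<Rightarrow> 'a \<Rightarrow> real) \<Rightarrow> nat \<Rightarrow> real \<Rightarrow> 'a list set" where
  "proper_chains_len M d n l = {xs \<in> proper_chains M n. chain_length d xs = l}"

definition four_cut ::
  "'a set \<Rightarrow> ('a \<Rightarrow> 'a \<Rightarrow> real) \<Rightarrow> 'a \<Rightarrow> 'a \<Rightarrow> 'a \<Rightarrow> 'a \<Rightarrow> bool" where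
  "four_cut M d x0 x1 x2 x3 \<longleftrightarrow>
     [x0, x1, x2, x3] \<in> proper_chains M 3 \<and>
     strictly_between d x0 x1 x2 \<and> strictly_between d x1 x2 x3 \<and>
     d x0 x3 < chain_length d [x0, x1, x2, x3]"

definition interval :: "'a set \<Rightarrow> ('a \<Rightarrow> 'a \<Rightarrow> real) \<Rightarrow> 'a \<Rightarrow> 'a \<Rightarrow> 'a set" where
  "interval M d a b = {x \<in> M. strictly_between d a x b}"

definition interval_order :: "'a set \<Rightarrow> ('a \<Rightarrow> 'a \<Rightarrow> real) \<Rightarrow> 'a \<Rightarrow> 'a \<Rightarrow> 'a rel" where
  "interval_order M d a b =
     {(x, y). x \<in> interval M d a b \<and> y \<in> interval M d a b \<and>
              a \<noteq> x \<and> d a x + d x y = d a y}"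

lemma partial_order_on_interval:
  assumes "Metric_space M d" "a \<in> M" "b \<in> M"
  shows "partial_order_on (interval M d a b) (interval_order M d a b)"
proof -
  interpret Metric_space M d by fact
  have tri: "d x z \<le> d x y + d y z" if "x \<in> M" "y \<in> M" "z \<in> M" for x y z
    using triangle that by blast
  have "trans (interval_order M d a b)"
  proof (rule transI)
    fix x y z
    assume "(x, y) \<in> interval_order M d a b" "(y, z) \<in> interval_order M d a b"
    then show "(x, z) \<in> interval_order M d a b"
      using tri[of a x z] tri[of x y z] \<open>a \<in> M\<close>
      by (auto simp: interval_order_def interval_def)
  qed
  moreover have "antisym (interval_order M d a b)"
  proof (rule antisymI)
    fix x y
    assume xy: "(x, y) \<in> interval_order M d a b" "(y, x) \<in> interval_order M d a b"
    then have "x \<in> M" "y \<in> M" "d x y + d y x = 0"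
      by (auto simp: interval_order_def interval_def)
    then show "x = y"
      using commute[of x y] by simp
  qed
  moreover have "refl_on (interval M d a b) (interval_order M d a b)"
    by (auto simp: refl_on_def interval_order_def interval_def strictly_between_def)
  ultimately show ?thesis
    by (auto simp: partial_order_on_def preorder_on_def interval_order_def)
qed

definition geodetic :: "'a set \<Rightarrow> ('a \<Rightarrow> 'a \<Rightarrow> real) \<Rightarrow> bool" where
  "geodetic M d \<longleftrightarrow>
     (\<forall>a\<in>M. \<forall>b\<in>M. linear_order_on (interval M d a b) (interval_order M d a b))"

definition magnitude_chain_group ::
  "'a set \<Rightarrow> ('a \<Rightarrow> 'a \<Rightarrow> real) \<Rightarrow> nat \<Rightarrow> real \<Rightarrow> ('a list \<Rightarrow>\<^sub>0 int) monoid" where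
  "magnitude_chain_group M d n l = free_Abelian_group (proper_chains_len M d n l)"

definition magnitude_face ::
  "('a \<Rightarrow> 'a \<Rightarrow> real) \<Rightarrow> nat \<Rightarrow> nat \<Rightarrow> 'a list \<Rightarrow> ('a list \<Rightarrow>\<^sub>0 int)" where
  "magnitude_face d n i xs =
     (if 1 \<le> i \<and> i < n \<and> strictly_between d (xs ! (i - 1)) (xs ! i) (xs ! (i + 1))
      then frag_of (take i xs @ drop (Suc i) xs) else 0)"

definition magnitude_boundary ::
  "('a \<Rightarrow> 'a \<Rightarrow> real) \<Rightarrow> nat \<Rightarrow> ('a list \<Rightarrow>\<^sub>0 int) \<Rightarrow> ('a list \<Rightarrow>\<^sub>0 int)" where
  "magnitude_boundary d n =
     frag_extend (\<lambda>xs. \<Sum>i\<le>n. frag_cmul ((-1) ^ i) (magnitude_face d n i xs))"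

text \<open>In degree 0 every face vanishes, so all 0-chains are cycles.\<close>

definition magnitude_cycles ::
  "'a set \<Rightarrow> ('a \<Rightarrow> 'a \<Rightarrow> real) \<Rightarrow> nat \<Rightarrow> real \<Rightarrow> ('a list \<Rightarrow>\<^sub>0 int) set" where
  "magnitude_cycles M d n l =
     {c \<in> carrier (magnitude_chain_group M d n l). magnitude_boundary d n c = 0}"

definition magnitude_boundaries ::
  "'a set \<Rightarrow> ('a \<Rightarrow> 'a \<Rightarrow> real) \<Rightarrow> nat \<Rightarrow> real \<Rightarrow> ('a list \<Rightarrow>\<^sub>0 int) set" where
  "magnitude_boundaries M d n l =
     magnitude_boundary d (Suc n) ` carrier (magnitude_chain_group M d (Suc n) l)"

definition magnitude_homology ::
  "'a set \<Rightarrow> ('a \<Rightarrow> 'a \<Rightarrow> real) \<Rightarrow> nat \<Rightarrow> real \<Rightarrow> ('a list \<Rightarrow>\<^sub>0 int) set monoid" where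
  "magnitude_homology M d n l =
     subgroup_generated (magnitude_chain_group M d n l) (magnitude_cycles M d n l)
       Mod magnitude_boundaries M d n l"

text \<open>
  The two suprema below are taken in \<^typ>\<open>ereal\<close>, where the supremum of the empty set is
  \<open>-\<infinity>\<close>; hence the explicit case distinctions.
\<close>

definition gap_distances :: "'a set \<Rightarrow> ('a \<Rightarrow> 'a \<Rightarrow> real) \<Rightarrow> ereal set" where
  "gap_distances M d =
     {ereal (d a b) | a b. a \<in> M \<and> b \<in> M \<and> a \<noteq> b \<and> interval M d a b = {}}"

definition gap_sup :: "'a set \<Rightarrow> ('a \<Rightarrow> 'a \<Rightarrow> real) \<Rightarrow> ereal" where
  "gap_sup M d = (if gap_distances M d = {} then 0 else Sup (gap_distances M d))"

definition nonvanishing_gradings :: "'a set \<Rightarrow> ('a \<Rightarrow> 'a \<Rightarrow> real) \<Rightarrow> nat \<Rightarrow> ereal set" where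
  "nonvanishing_gradings M d k =
     {ereal l | l. 0 < l \<and> \<not> trivial_group (magnitude_homology M d k l)}"

definition vanishing_threshold :: "'a set \<Rightarrow> ('a \<Rightarrow> 'a \<Rightarrow> real) \<Rightarrow> nat \<Rightarrow> ereal" where
  "vanishing_threshold M d k =
     (if nonvanishing_gradings M d k = {} then 0 else Sup (nonvanishing_gradings M d k))"

end

theory Submission
  imports Defs
begin

text \<open>
  Call a chain thin if \<open>I\<^sub>X(x, y)\<close> is empty for all consecutive points \<open>x, y\<close>. Call a
  point \<open>x\<^sub>i\<close> of a chain smooth if \<open>x\<^sub>i\<^sub>-\<^sub>1 \<prec> x\<^sub>i \<prec> x\<^sub>i\<^sub>+\<^sub>1\<close>. Without 4-cuts, removing
  a smooth point from a chain does not affect which of the other points are smooth, so the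
  boundary preserves the maximal geodesic segments of a chain. If some segment from \<open>a\<close> to \<open>b\<close> has
  \<open>I\<^sub>X(a, b) \<noteq> \<emptyset>\<close>, choose a point \<open>c\<close> of this interval, which depends only on \<open>a\<close> and \<open>b\<close>, for the first
  such segment. As the interval is totally ordered, \<open>c\<close> can be inserted into the segment, and this
  cone construction contracts the complex away from the thin chains. Hence \<open>H\<^sub>k\<^sup>\<ell> \<noteq> 0\<close> forces a thin
  chain of length \<open>\<ell>\<close>, so \<open>\<ell> \<le> k h\<^sub>X\<close>, with equality only if all its steps have length \<open>h\<^sub>X\<close>.
  Conversely, for \<open>I\<^sub>X(a, b) = \<emptyset>\<close> the chain \<open>(a, b, a, b, \<dots>)\<close> is a cycle of length \<open>k d(a, b)\<close>, and it
  occurs in no boundary because a face is never thin.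
\<close>

section \<open>Linearity of \<open>frag_extend\<close> in the function\<close>

lemma frag_extend_uminus_fun: "frag_extend (\<lambda>x. - f x) c = - frag_extend f c"
  using subset_UNIV[of "Poly_Mapping.keys c"]
  by (induction c rule: frag_induction) (simp_all add: frag_extend_diff)

lemma frag_extend_diff_fun: "frag_extend (\<lambda>x. f x - g x) c = frag_extend f c - frag_extend g c"
  using subset_UNIV[of "Poly_Mapping.keys c"]
  by (induction c rule: frag_induction) (simp_all add: frag_extend_diff)

lemma frag_extend_add_fun: "frag_extend (\<lambda>x. f x + g x) c = frag_extend f c + frag_extend g c"
  using subset_UNIV[of "Poly_Mapping.keys c"]
  by (induction c rule: frag_induction) (simp_all add: frag_extend_diff)

lemma frag_extend_comp: "frag_extend (\<lambda>x. frag_extend g (f x)) c = frag_extend g (frag_extend f c)"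
  using subset_UNIV[of "Poly_Mapping.keys c"]
  by (induction c rule: frag_induction) (simp_all add: frag_extend_diff)

lemmas frag_extend_linear =
  frag_extend_add frag_extend_diff frag_extend_minus
  frag_extend_uminus_fun frag_extend_diff_fun frag_extend_add_fun frag_extend_comp
  frag_expansion[symmetric]

subsection \<open>The boundary by recursion on lists\<close>

definition cons_frag :: "'a \<Rightarrow> ('a list \<Rightarrow>\<^sub>0 int) \<Rightarrow> ('a list \<Rightarrow>\<^sub>0 int)" where
  "cons_frag x = frag_extend (\<lambda>L. frag_of (x # L))"

lemma cons_frag_simps [simp]:
  "cons_frag x 0 = 0"
  "cons_frag x (frag_of L) = frag_of (x # L)"
  "cons_frag x (- c) = - cons_frag x c"
  "cons_frag x (c + c') = cons_frag x c + cons_frag x c'"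
  "cons_frag x (c - c') = cons_frag x c - cons_frag x c'"
  by (simp_all add: cons_frag_def frag_extend_linear)

lemma frag_extend_cons_frag: "frag_extend f (cons_frag x c) = frag_extend (\<lambda>L. f (x # L)) c"
  by (simp add: cons_frag_def frag_extend_comp[symmetric])

lemma frag_extend_fun_cons_frag:
  "frag_extend (\<lambda>L. cons_frag x (f L)) c = cons_frag x (frag_extend f c)"
  by (simp add: cons_frag_def frag_extend_comp)

lemma keys_cons_frag: "Poly_Mapping.keys (cons_frag x c) \<subseteq> (#) x ` Poly_Mapping.keys c"
  unfolding cons_frag_def using keys_frag_extend[of "\<lambda>L. frag_of (x # L)" c] by (auto simp: keys_frag_of)

text \<open>Recursion on the list makes the boundary accessible to induction on chains. The minus
  sign in front of the tail accounts for the shift of all positions by one.\<close>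

fun list_boundary :: "('a \<Rightarrow> 'a \<Rightarrow> real) \<Rightarrow> 'a list \<Rightarrow> ('a list \<Rightarrow>\<^sub>0 int)" where
  "list_boundary d (x # y # z # r) =
     (if strictly_between d x y z then - frag_of (x # z # r) else 0) - cons_frag x (list_boundary d (y # z # r))"
| "list_boundary d _ = 0"

text \<open>An upper bound for the support of \<open>list_boundary\<close>. Properties of faces can
  be proved on this set without any argument about coefficients or cancellation.\<close>

fun faces :: "('a \<Rightarrow> 'a \<Rightarrow> real) \<Rightarrow> 'a list \<Rightarrow> 'a list set" where
  "faces d (x # y # z # r) =
     (if strictly_between d x y z then {x # z # r} else {}) \<union> (#) x ` faces d (y # z # r)"
| "faces d _ = {}"

lemma keys_list_boundary: "Poly_Mapping.keys (list_boundary d L) \<subseteq> faces d L"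
proof (induction L rule: faces.induct)
  case (1 d x y z r)
  have "Poly_Mapping.keys (cons_frag x (list_boundary d (y # z # r))) \<subseteq> (#) x ` faces d (y # z # r)"
    using keys_cons_frag[of x] 1 by blast
  moreover have "Poly_Mapping.keys (list_boundary d (x # y # z # r)) \<subseteq>
    Poly_Mapping.keys (if strictly_between d x y z then - frag_of (x # z # r) else 0)
    \<union> Poly_Mapping.keys (cons_frag x (list_boundary d (y # z # r)))"
    using keys_diff by (simp only: list_boundary.simps)
  ultimately show ?case
    by (auto simp: keys_frag_of split: if_splits)
qed auto

lemma faces_Cons: "L \<in> faces d L' \<Longrightarrow> x # L \<in> faces d (x # L')"
  by (cases "(d, L')" rule: faces.cases) auto

lemma faces_Cons_cases:
  assumes "L' \<in> faces d L"
  obtains y t t' where "L = y # t" "L' = y # t'" "t \<noteq> []" "t' \<noteq> []"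
  using assms by (induction L arbitrary: L' thesis rule: faces.induct) (auto split: if_splits)

lemma length_faces: "L' \<in> faces d L \<Longrightarrow> length L = Suc (length L')"
  by (induction L arbitrary: L' rule: faces.induct) (auto split: if_splits)

text \<open>Face 0 vanishes, face 1 is the first summand of the recursion, and face i + 2 of the
  chain is face i + 1 of its tail with the first point prepended.\<close>

lemma alternating_face_sum:
  assumes "length L = Suc n"
  shows "(\<Sum>i\<le>n. frag_cmul ((-1) ^ i) (magnitude_face d n i L)) = list_boundary d L"
  using assms
proof (induction d L arbitrary: n rule: list_boundary.induct)
  case (1 d x y z r)
  then obtain m where n: "n = Suc m" and m: "length (y # z # r) = Suc m" by auto
  then obtain k where k: "m = Suc k" by (cases m) auto
  have face: "magnitude_face d n (Suc (Suc i)) (x # y # z # r) = cons_frag x (magnitude_face d m (Suc i) (y # z # r))" for i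
    unfolding magnitude_face_def n by auto
  have face1: "magnitude_face d n 1 (x # y # z # r) = (if strictly_between d x y z then frag_of (x # z # r) else 0)"
    using m unfolding magnitude_face_def n by auto
  have face0: "magnitude_face d j 0 L = 0" for j L
    by (simp add: magnitude_face_def)
  have cm: "cons_frag x (frag_cmul c f) = frag_cmul c (cons_frag x f)" for c f
    by (simp add: cons_frag_def frag_extend_cmul)
  have cs: "cons_frag x (sum f A) = (\<Sum>i\<in>A. cons_frag x (f i))" if "finite A" for f and A :: "nat set"
    using that by (induction A rule: finite_induct) auto
  have "(\<Sum>i\<le>n. frag_cmul ((-1) ^ i) (magnitude_face d n i (x # y # z # r))) =
     - magnitude_face d n 1 (x # y # z # r)
     + (\<Sum>i\<le>k. frag_cmul ((-1) ^ (Suc (Suc i))) (magnitude_face d n (Suc (Suc i)) (x # y # z # r)))"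
    unfolding n k by (simp only: sum.atMost_Suc_shift) (simp add: face0)
  also have "(\<Sum>i\<le>k. frag_cmul ((-1) ^ (Suc (Suc i))) (magnitude_face d n (Suc (Suc i)) (x # y # z # r))) =
     - cons_frag x (\<Sum>i\<le>k. frag_cmul ((-1) ^ (Suc i)) (magnitude_face d m (Suc i) (y # z # r)))"
    by (simp add: face cs cm sum_negf[symmetric])
  also have "(\<Sum>i\<le>k. frag_cmul ((-1) ^ (Suc i)) (magnitude_face d m (Suc i) (y # z # r))) =
     (\<Sum>i\<le>m. frag_cmul ((-1) ^ i) (magnitude_face d m i (y # z # r)))"
    unfolding k by (simp only: sum.atMost_Suc_shift) (simp add: face0)
  also have "\<dots> = list_boundary d (y # z # r)"
    using 1(1)[OF m] .
  finally show ?case by (simp add: face1[simplified])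
qed (auto simp: magnitude_face_def atMost_Suc)

lemma magnitude_boundary_eq:
  assumes "\<And>L. L \<in> Poly_Mapping.keys c \<Longrightarrow> length L = Suc n"
  shows "magnitude_boundary d n c = frag_extend (list_boundary d) c"
  unfolding magnitude_boundary_def
  by (intro frag_extend_eq alternating_face_sum assms)

lemma proper_chains_iff:
  "L \<in> proper_chains M n \<longleftrightarrow> length L = Suc n \<and> set L \<subseteq> M \<and> distinct_adj L"
proof -
  have "(\<forall>i\<in>{1..n}. L ! (i - 1) \<noteq> L ! i) \<longleftrightarrow> (\<forall>i. Suc i < Suc n \<longrightarrow> L ! i \<noteq> L ! Suc i)"
  proof (intro iffI allI impI ballI)
    fix i assume "\<forall>i\<in>{1..n}. L ! (i - 1) \<noteq> L ! i" "Suc i < Suc n"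
    then show "L ! i \<noteq> L ! Suc i" by (auto dest: bspec[of _ _ "Suc i"])
  next
    fix i assume "\<forall>i. Suc i < Suc n \<longrightarrow> L ! i \<noteq> L ! Suc i" "i \<in> {1..n}"
    then show "L ! (i - 1) \<noteq> L ! i" by (cases i) auto
  qed
  then show ?thesis
    unfolding proper_chains_def distinct_adj_conv_nth by auto
qed

lemma chain_length_simps [simp]:
  "chain_length d [] = 0"
  "chain_length d [x] = 0"
  "chain_length d (x # y # r) = d x y + chain_length d (y # r)"
proof -
  show "chain_length d (x # y # r) = d x y + chain_length d (y # r)"
    unfolding chain_length_def
    by (simp add: sum.atLeast_Suc_lessThan sum.shift_bounds_Suc_ivl del: sum.op_ivl_Suc)
qed (simp_all add: chain_length_def)

lemma chain_length_faces:
  "L' \<in> faces d L \<Longrightarrow> chain_length d L' = chain_length d L"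
proof (induction d L arbitrary: L' rule: faces.induct)
  case (1 d x y z r)
  show ?case
  proof (cases "L' = x # z # r \<and> strictly_between d x y z")
    case True
    then show ?thesis
      by (simp add: strictly_between_def weakly_between_def)
  next
    case False
    then obtain t where t: "L' = x # t" "t \<in> faces d (y # z # r)"
      using "1.prems" by (auto split: if_splits)
    then obtain t' where "t = y # t'"
      by (auto elim: faces_Cons_cases)
    then show ?thesis
      using "1.IH"[OF t(2)] t by simp
  qed
qed auto

section \<open>Betweenness in metric spaces and the square of the boundary\<close>

context Metric_space
begin

abbreviation sb :: "'a \<Rightarrow> 'a \<Rightarrow> 'a \<Rightarrow> bool" where
  "sb \<equiv> strictly_between d"

definition pchain :: "'a list \<Rightarrow> bool" where
  "pchain L \<longleftrightarrow> L \<noteq> [] \<and> set L \<subseteq> M \<and> distinct_adj L"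

lemma pchain_simps [simp]:
  "pchain [x] \<longleftrightarrow> x \<in> M"
  "pchain (x # y # r) \<longleftrightarrow> x \<in> M \<and> x \<noteq> y \<and> pchain (y # r)"
  by (auto simp: pchain_def)

lemma sb_neq:
  assumes "sb x y z" "x \<in> M" "y \<in> M" "z \<in> M"
  shows "x \<noteq> z" "x \<noteq> y" "y \<noteq> z"
proof -
  show "x \<noteq> y" "y \<noteq> z" using assms by (auto simp: strictly_between_def)
  show "x \<noteq> z"
  proof
    assume "x = z"
    then have "d x y + d y x = 0" using assms by (auto simp: strictly_between_def weakly_between_def)
    then have "d x y = 0" using nonneg[of x y] nonneg[of y x] by linarith
    then show False using assms by (auto simp: strictly_between_def)
  qed
qed

text \<open>By the triangle inequality, d(x,w) is at most d(x,z) + d(z,w), hence at most d(x,y) +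
  d(y,z) + d(z,w) = d(x,w). So equality holds throughout.\<close>

lemma sb_assoc:
  assumes "sb x y w" "sb y z w" "x \<in> M" "y \<in> M" "z \<in> M" "w \<in> M"
  shows "sb x y z" "sb x z w"
proof -
  have e: "d x y + d y w = d x w" "d y z + d z w = d y w"
    using assms by (auto simp: strictly_between_def weakly_between_def)
  have t: "d x z \<le> d x y + d y z" "d x w \<le> d x z + d z w"
    using assms triangle by auto
  have e2: "d x y + d y z = d x z" "d x z + d z w = d x w" using e t by linarith+
  then show xyz: "sb x y z"
    using assms by (auto simp: strictly_between_def weakly_between_def)
  then have "x \<noteq> z" using sb_neq assms by blast
  then show "sb x z w"
    using assms e2 by (auto simp: strictly_between_def weakly_between_def)
qed

text \<open>This is \<open>sb_assoc\<close> read along the reversed points w, z, y, x.\<close>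

lemma sb_assoc':
  assumes "sb x z w" "sb x y z" "x \<in> M" "y \<in> M" "z \<in> M" "w \<in> M"
  shows "sb y z w" "sb x y w"
proof -
  have s: "sb w z x" "sb z y x"
    using assms by (auto simp: strictly_between_def weakly_between_def commute)
  show "sb y z w" "sb x y w"
    using sb_assoc[OF s] assms by (auto simp: strictly_between_def weakly_between_def commute)
qed

lemma faces_pchain: "L' \<in> faces d L \<Longrightarrow> pchain L \<Longrightarrow> pchain L'"
proof (induction L arbitrary: L' rule: induct_list012)
  case (3 x y r)
  then obtain z r' where r: "r = z # r'" by (cases r) auto
  from "3.prems" have mem: "x \<in> M" "y \<in> M" "z \<in> M" "pchain (y # r)" "x \<noteq> y"
    by (auto simp: r pchain_def)
  show ?case
  proof (cases "L' = x # z # r' \<and> sb x y z")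
    case True
    then show ?thesis
      using "3.prems" mem sb_neq[of x y z] by (simp add: r)
  next
    case False
    then obtain t where "L' = x # t" "t \<in> faces d (y # z # r')"
      using "3.prems" by (auto simp: r split: if_splits)
    then show ?thesis
      using "3.IH"(2)[of t] mem by (auto simp: r elim!: faces_Cons_cases)
  qed
qed auto


text \<open>Prepending x may make the first point of a term smooth. If the answer \<open>b\<close>
  is the same for all terms of \<open>c\<close>, prepending commutes with the boundary up to sign
  and one correction, in which that point is removed.\<close>

lemma boundary_cons_frag:
  assumes "\<And>L. L \<in> Poly_Mapping.keys c \<Longrightarrow> \<exists>y z r. L = y # z # r \<and> (sb x y z \<longleftrightarrow> b)"
  shows "frag_extend (list_boundary d) (cons_frag x c) =
    (if b then - frag_extend (\<lambda>L. frag_of (x # tl L)) c else 0) - cons_frag x (frag_extend (list_boundary d) c)"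
proof -
  have "frag_extend (list_boundary d) (cons_frag x c) =
    frag_extend (\<lambda>L. (if b then - frag_of (x # tl L) else 0) - cons_frag x (list_boundary d L)) c"
    unfolding frag_extend_cons_frag using assms by (intro frag_extend_eq) fastforce
  then show ?thesis
    by (auto simp: frag_extend_diff_fun frag_extend_uminus_fun frag_extend_fun_cons_frag frag_extend_eq_0)
qed

lemma faces_Cons2_cases:
  assumes "L' \<in> faces d L"
  obtains y z t z' t' where "L = y # z # t" "L' = y # z' # t'"
  using assms by (elim faces_Cons_cases) (auto simp: neq_Nil_conv)

lemma list_boundary_squared: "pchain L \<Longrightarrow> frag_extend (list_boundary d) (list_boundary d L) = 0"
proof (induction L rule: induct_list012)
  case (3 x y s)
  show ?case
  proof (cases "\<exists>z w r. s = z # w # r")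
    case False
    then have "s = [] \<or> (\<exists>z. s = [z])"
      by (metis neq_Nil_conv)
    then show ?thesis
      by (auto simp: frag_extend_linear)
  next
    case True
    then obtain z w r where s: "s = z # w # r" by blast
    let ?D = "frag_extend (list_boundary d)"
    let ?T = "list_boundary d (z # w # r)"
    have mem: "x \<in> M" "y \<in> M" "z \<in> M" "w \<in> M"
      using "3.prems" by (cases r; auto simp: s)+
    have IH: "?D (list_boundary d (y # z # w # r)) = 0"
      using "3.IH"(2) "3.prems" by (simp add: s)
    \<comment> \<open>The points y and z can be removed in one order iff they can be removed in the
      other. The two resulting terms have opposite signs.\<close>
    have sq: "sb x y z \<and> sb x z w \<longleftrightarrow> sb y z w \<and> sb x y w"
      using sb_assoc[of x y w z] sb_assoc'[of x z w y] mem by blast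
    \<comment> \<open>Every term of \<open>?T\<close> still starts with z, so the smoothness of y
      between x and z is the same in all terms of
      \<open>cons_frag x (cons_frag y ?T)\<close>.\<close>
    have hd_T: "\<exists>t. L = z # t \<and> t \<noteq> []" if "L \<in> Poly_Mapping.keys ?T" for L
      using that keys_list_boundary[of d "z # w # r"] by (auto elim!: faces_Cons_cases)
    have "?D (cons_frag x (cons_frag y ?T)) =
      (if sb x y z then - frag_extend (\<lambda>L. frag_of (x # tl L)) (cons_frag y ?T) else 0)
      - cons_frag x (?D (cons_frag y ?T))"
      by (intro boundary_cons_frag) (use keys_cons_frag[of y ?T] hd_T in blast)
    moreover have "frag_extend (\<lambda>L. frag_of (x # tl L)) (cons_frag y ?T) = cons_frag x ?T"
      by (simp add: frag_extend_cons_frag) (simp add: cons_frag_def)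
    ultimately have DT: "?D (cons_frag x (cons_frag y ?T)) =
      (if sb x y z then - cons_frag x ?T else 0) - cons_frag x (?D (cons_frag y ?T))"
      by simp
    have IH': "(if sb y z w then - cons_frag x (list_boundary d (y # w # r)) else 0)
       - cons_frag x (?D (cons_frag y ?T)) = 0"
      using arg_cong[OF IH, of "cons_frag x"] by (auto simp: frag_extend_linear split: if_splits)
    show ?thesis
      using sq IH' unfolding s
      by (cases "sb x y z"; cases "sb x z w"; cases "sb y z w"; cases "sb x y w")
         (simp_all add: frag_extend_linear DT del: list_boundary.simps(1),
          simp_all add: frag_extend_linear DT)
  qed
qed auto

end

subsection \<open>Insertion of points into geodesic segments\<close>

text \<open>The end of the first maximal geodesic segment. Only consecutive triples are tested;
  without 4-cuts this suffices to place the inner points between the ends, see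
  \<open>sb_segment_end\<close>.\<close>

fun segment_end :: "('a \<Rightarrow> 'a \<Rightarrow> real) \<Rightarrow> 'a list \<Rightarrow> 'a" where
  "segment_end d (x # y # z # r) = (if strictly_between d x y z then segment_end d (y # z # r) else y)"
| "segment_end d [x, y] = y"
| "segment_end d [x] = x"
| "segment_end d [] = undefined"

text \<open>
  The insertion is signed by its position, and \<open>c\<close> should lie in the interval spanned by the first
  geodesic segment of the chain; otherwise the value has no meaning.
\<close>

fun insert_point :: "'a set \<Rightarrow> ('a \<Rightarrow> 'a \<Rightarrow> real) \<Rightarrow> 'a \<Rightarrow> 'a list \<Rightarrow> ('a list \<Rightarrow>\<^sub>0 int)" where
  "insert_point M d c (x # y # r) =
     (if y = c then 0
      else if c \<in> interval M d x y then - frag_of (x # c # y # r)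
      else - cons_frag x (insert_point M d c (y # r)))"
| "insert_point M d c _ = 0"

text \<open>The cone construction. The chosen point depends only on the set \<open>I\<close>, so
  chains whose first segments have the same ends receive the same point. In a proper chain, an empty
  \<open>I\<close> means that the first segment is a single step, which is then skipped.\<close>

fun contraction :: "'a set \<Rightarrow> ('a \<Rightarrow> 'a \<Rightarrow> real) \<Rightarrow> 'a list \<Rightarrow> ('a list \<Rightarrow>\<^sub>0 int)" where
  "contraction M d (x # y # r) =
     (let I = interval M d x (segment_end d (x # y # r))
      in if I = {} then - cons_frag x (contraction M d (y # r))
         else insert_point M d (SOME c. c \<in> I) (x # y # r))"
| "contraction M d _ = 0"

fun thin :: "'a set \<Rightarrow> ('a \<Rightarrow> 'a \<Rightarrow> real) \<Rightarrow> 'a list \<Rightarrow> bool" where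
  "thin M d (x # y # r) \<longleftrightarrow> interval M d x y = {} \<and> thin M d (y # r)"
| "thin M d _ \<longleftrightarrow> True"

section \<open>First geodesic segments in geodetic spaces without 4-cuts\<close>

locale geodetic_no_cut = Metric_space +
  assumes geodetic: "geodetic M d"
    and no_cut: "\<not> four_cut M d x0 x1 x2 x3"
begin

abbreviation bd :: "('a list \<Rightarrow>\<^sub>0 int) \<Rightarrow> ('a list \<Rightarrow>\<^sub>0 int)" where
  "bd \<equiv> frag_extend (list_boundary d)"

text \<open>If d(x,w) were smaller than d(x,y) + d(y,z) + d(z,w), then (x,y,z,w) would be a
  4-cut.\<close>

lemma sb_extend:
  assumes "sb x y z" "sb y z w" "x \<in> M" "y \<in> M" "z \<in> M" "w \<in> M"
  shows "sb x y w" "sb x z w"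
proof -
  have "[x, y, z, w] \<in> proper_chains M 3"
    using assms by (auto simp: proper_chains_iff strictly_between_def)
  then have "\<not> d x w < d x y + d y z + d z w"
    using assms no_cut[of x y z w] by (auto simp: four_cut_def)
  moreover have "d x w \<le> d x z + d z w"
    using assms triangle by blast
  moreover have eq: "d x y + d y z = d x z" "d y z + d z w = d y w"
    using assms by (auto simp: strictly_between_def weakly_between_def)
  ultimately have "d x y + d y w = d x w"
    by linarith
  moreover have "y \<noteq> w"
    using sb_neq(1)[of y z w] assms by auto
  ultimately show "sb x y w"
    using assms by (auto simp: strictly_between_def weakly_between_def)
  then show "sb x z w"
    using sb_assoc[of x y w z] assms by blast
qed

text \<open>Here geodeticity enters: c and y are comparable in the total order on the interval from
  x to e.\<close>

lemma interval_cases: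
  assumes "sb x c e" "sb x y e" "x \<in> M" "y \<in> M" "c \<in> M" "e \<in> M"
  obtains "y = c" | "sb x c y" | "sb x y c"
proof -
  have "linear_order_on (interval M d x e) (interval_order M d x e)"
    using geodetic assms by (auto simp: geodetic_def)
  moreover have "c \<in> interval M d x e" "y \<in> interval M d x e"
    using assms by (auto simp: interval_def)
  ultimately have "y = c \<or> (y, c) \<in> interval_order M d x e \<or> (c, y) \<in> interval_order M d x e"
    unfolding linear_order_on_def total_on_def by auto
  then show ?thesis
    using that by (auto simp: interval_order_def interval_def strictly_between_def weakly_between_def)
qed

lemma segment_end_in: "pchain L \<Longrightarrow> segment_end d L \<in> M"
  by (induction d L rule: segment_end.induct) (auto simp: pchain_def)

lemma sb_segment_end:
  "pchain (y # z # r) \<Longrightarrow> z = segment_end d (y # z # r) \<or> sb y z (segment_end d (y # z # r))"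
proof (induction r arbitrary: y z)
  case (Cons w r)
  have mem: "y \<in> M" "z \<in> M" "w \<in> M" "segment_end d (z # w # r) \<in> M"
    using Cons.prems segment_end_in[of "z # w # r"] by (auto simp: pchain_def)
  show ?case
    using Cons.IH[of z w] Cons.prems sb_extend[of y z w "segment_end d (z # w # r)"] mem by auto
qed auto

text \<open>The smoothness of y behind x depends only on the end of the segment that starts at y.
  Hence it survives every change inside that segment that keeps its ends.\<close>

lemma sb_segment_end_iff:
  assumes "pchain (y # z # r)" "x \<in> M"
  shows "sb x y (segment_end d (y # z # r)) \<longleftrightarrow> sb x y z"
proof -
  let ?e = "segment_end d (y # z # r)"
  have mem: "y \<in> M" "z \<in> M" "?e \<in> M"
    using assms segment_end_in[of "y # z # r"] by (auto simp: pchain_def)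
  show ?thesis
    using sb_segment_end[OF assms(1)] sb_extend[of x y z ?e] sb_assoc[of x y ?e z] mem assms(2) by metis
qed

text \<open>Unlike the defining equation, this recursion does not mention the point after y, which
  may change when a face of the tail is taken.\<close>

lemma segment_end_Cons:
  assumes "pchain (y # z # r)" "x \<in> M"
  shows "segment_end d (x # y # z # r) =
    (if sb x y (segment_end d (y # z # r)) then segment_end d (y # z # r) else y)"
  using sb_segment_end_iff[OF assms] by auto

lemma segment_end_faces:
  "L' \<in> faces d L \<Longrightarrow> pchain L \<Longrightarrow> segment_end d L' = segment_end d L"
proof (induction L arbitrary: L' rule: induct_list012)
  case (3 x y s)
  then obtain z r where s: "s = z # r" by (cases s) auto
  have mem: "x \<in> M" "y \<in> M" "z \<in> M" "pchain (y # z # r)" "pchain (z # r)"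
    using "3.prems" by (auto simp: s pchain_def)
  show ?case
  proof (cases "L' = x # z # r \<and> sb x y z")
    case True
    show ?thesis
    proof (cases r)
      case Nil
      then show ?thesis using True by (simp add: s)
    next
      case (Cons w r')
      let ?e = "segment_end d (z # w # r')"
      have "w \<in> M" using mem by (simp add: Cons pchain_def)
      \<comment> \<open>Removing the smooth point y does not affect whether z is smooth.\<close>
      then have "sb x z w \<longleftrightarrow> sb y z w"
        using sb_extend[of x y z w] sb_assoc'[of x z w y] mem True by blast
      then show ?thesis using True by (simp add: s Cons)
    qed
  next
    case False
    then obtain t where t: "L' = x # t" "t \<in> faces d (y # z # r)"
      using "3.prems" by (auto simp: s split: if_splits)
    then obtain z' t' where t': "t = y # z' # t'"
      by (auto elim: faces_Cons2_cases)
    have "pchain t" using faces_pchain t mem by blast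
    then show ?thesis
      using "3.IH"(2)[of t] t mem
      by (simp add: s t' segment_end_Cons del: segment_end.simps(1))
  qed
qed auto

text \<open>If y were the end of the segment, c would fit between x and y. So the segment continues
  behind y, and comparability of c and y puts c either at y or behind it.\<close>

lemma insert_later_cases:
  assumes "pchain (x # y # r)" "sb x c (segment_end d (x # y # r))" "c \<in> M" "\<not> sb x c y"
  obtains z r' where "r = z # r'" "sb x y z"
    and "y \<noteq> c \<Longrightarrow> sb x y c" "y \<noteq> c \<Longrightarrow> sb y c (segment_end d (y # r))"
proof -
  let ?e = "segment_end d (x # y # r)"
  have mem: "x \<in> M" "y \<in> M" "?e \<in> M"
    using assms segment_end_in[of "x # y # r"] by (auto simp: pchain_def)
  have "y \<noteq> ?e"
    using assms by auto
  then have xye: "sb x y ?e"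
    using sb_segment_end assms by blast
  obtain z r' where r: "r = z # r'"
    using \<open>y \<noteq> ?e\<close> by (cases r) auto
  have xyz: "sb x y z"
    using \<open>y \<noteq> ?e\<close> by (auto simp: r split: if_splits)
  have xyc: "sb x y c" if "y \<noteq> c"
    using interval_cases[of x c ?e y] that assms xye mem by blast
  have "sb y c ?e" if "y \<noteq> c"
    using sb_assoc'[of x c ?e y] xyc that assms mem by blast
  then show ?thesis
    using that[OF r xyz xyc] xyz by (simp add: r)
qed

text \<open>Stating the result as a face relation makes the lemmas on faces applicable, which
  transfer segment ends, degrees and lengths between \<open>L\<close> and \<open>L'\<close>.\<close>

lemma keys_insert_point:
  assumes "pchain L" "sb (hd L) c (segment_end d L)" "c \<in> M"
    and "L' \<in> Poly_Mapping.keys (insert_point M d c L)"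
  shows "pchain L' \<and> L \<in> faces d L'"
  using assms
proof (induction L arbitrary: L' rule: induct_list012)
  case (3 x y r)
  have mem: "x \<in> M" "y \<in> M" "x \<noteq> y" "pchain (y # r)"
    using "3.prems"(1) by (auto simp: pchain_def)
  from "3.prems" consider (gap) "sb x c y" "L' = x # c # y # r"
    | (step) t where "y \<noteq> c" "\<not> sb x c y" "L' = x # t" "t \<in> Poly_Mapping.keys (insert_point M d c (y # r))"
    using keys_cons_frag[of x "insert_point M d c (y # r)"]
    by (auto simp: interval_def keys_frag_of split: if_splits)
  then show ?case
  proof cases
    case gap
    then show ?thesis
      using mem "3.prems" sb_neq[of x c y] by simp
  next
    case step
    have "sb y c (segment_end d (y # r))"
      using insert_later_cases[of x y r c] step "3.prems" by (metis list.sel(1))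
    then have IH: "pchain t" "y # r \<in> faces d t"
      using "3.IH"(2)[of t] step "3.prems" mem by auto
    moreover obtain t' where "t = y # t'"
      using faces_Cons_cases[OF IH(2)] by auto
    ultimately show ?thesis
      using step mem faces_Cons by auto
  qed
qed auto

lemma faces_same_hd: "L \<in> faces d (y # r) \<Longrightarrow> \<exists>t. L = y # t"
  by (auto elim: faces_Cons_cases)

text \<open>If c is not yet in the first segment, removing the inserted c gives L back, while
  removal of other points commutes with the insertion up to sign. If c is already there, nothing is
  inserted into L or into the faces that keep c, and reinserting c into the face without it gives
  L.\<close>

lemma insert_point_homotopy:
  assumes "pchain L" "sb (hd L) c (segment_end d L)" "c \<in> M"
  shows "bd (insert_point M d c L) + frag_extend (insert_point M d c) (list_boundary d L) = frag_of L"
  using assms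
proof (induction L rule: induct_list012)
  case (2 x)
  then show ?case using sb_neq(1)[of x c x] by simp
next
  case (3 x y r)
  let ?J = "insert_point M d c"
  have mem: "x \<in> M" "y \<in> M" "x \<noteq> y" "pchain (y # r)" "c \<in> M"
    using "3.prems" by (auto simp: pchain_def)
  have keys_D: "\<exists>t. L = y # t" if "L \<in> Poly_Mapping.keys (list_boundary d (y # r))" for L
    using that keys_list_boundary faces_same_hd by blast
  consider (here) "y = c" | (gap) "y \<noteq> c" "sb x c y" | (later) "y \<noteq> c" "\<not> sb x c y"
    by blast
  then show ?case
  proof cases
    case here
    then have "\<not> sb x c y"
      by (simp add: strictly_between_def)
    then obtain z r' where r: "r = z # r'" and xyz: "sb x c z"
      using insert_later_cases[of x y r c] "3.prems" here by (metis list.sel(1))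
    \<comment> \<open>These faces keep c as second point, so the insertion vanishes on them.\<close>
    have "frag_extend (\<lambda>L. ?J (x # L)) (list_boundary d (y # r)) = 0"
      by (intro frag_extend_eq_0) (use keys_D here in force)
    moreover have "?J (x # z # r') = - frag_of (x # c # z # r')"
      using xyz mem by (auto simp: interval_def strictly_between_def)
    ultimately show ?thesis
      using xyz by (simp add: here r frag_extend_linear frag_extend_cons_frag del: list_boundary.simps(1) insert_point.simps(1))
        (simp add: frag_extend_linear frag_extend_cons_frag)
  next
    case gap
    show ?thesis
    proof (cases r)
      case Nil
      then show ?thesis
        using gap mem by (simp add: interval_def frag_extend_linear)
    next
      case (Cons z r')
      have z: "z \<in> M"
        using mem by (simp add: Cons pchain_def)
      \<comment> \<open>The point c goes directly behind x whenever the next point lies beyond c.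
        This is used for y, and for z when y has been removed.\<close>
      have J: "?J (x # c' # t) = - frag_of (x # c # c' # t)" if "sb x c c'" for c' t
        using that mem by (auto simp: interval_def strictly_between_def)
      have "frag_extend (\<lambda>L. ?J (x # L)) (list_boundary d (y # r)) =
          frag_extend (\<lambda>L. - frag_of (x # c # L)) (list_boundary d (y # r))"
        by (intro frag_extend_eq) (use keys_D J gap in force)
      also have "\<dots> = - cons_frag x (cons_frag c (list_boundary d (y # r)))"
        by (simp add: frag_extend_uminus_fun cons_frag_def frag_extend_comp[symmetric])
      finally have JD: "frag_extend (\<lambda>L. ?J (x # L)) (list_boundary d (y # r)) =
          - cons_frag x (cons_frag c (list_boundary d (y # r)))" .
      \<comment> \<open>The insertion of c before y does not change whether y is smooth, and c still
        fits before z once y is gone.\<close>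
      have iff: "sb c y z \<longleftrightarrow> sb x y z" and xcz: "sb x y z \<Longrightarrow> sb x c z"
        using gap sb_extend[of x c y z] sb_assoc'[of x y z c] mem z by blast+
      have "list_boundary d (x # y # r) =
          (if sb x y z then - frag_of (x # z # r') else 0) - cons_frag x (list_boundary d (y # r))"
        by (simp add: Cons)
      then have "frag_extend ?J (list_boundary d (x # y # r)) =
          (if sb x y z then frag_of (x # c # z # r') else 0) + cons_frag x (cons_frag c (list_boundary d (y # r)))"
        using J[of z r'] xcz JD by (auto simp: frag_extend_linear frag_extend_cons_frag simp del: insert_point.simps)
      moreover have "list_boundary d (c # y # r) =
          (if sb x y z then - frag_of (c # z # r') else 0) - cons_frag c (list_boundary d (y # r))"
        using iff by (simp add: Cons)
      moreover have "bd (?J (x # y # r)) = frag_of (x # y # r) + cons_frag x (list_boundary d (c # y # r))"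
        using J[OF gap(2)] gap by (simp add: frag_extend_linear del: insert_point.simps)
      ultimately show ?thesis
        by simp
    qed
  next
    case later
    then obtain z r' where r: "r = z # r'" and xyz: "sb x y z" and xyc: "sb x y c"
      and yce: "sb y c (segment_end d (y # r))"
      using insert_later_cases[of x y r c] "3.prems" by (metis list.sel(1))
    have z: "z \<in> M"
      using mem by (simp add: r pchain_def)
    have IH: "bd (?J (y # r)) + frag_extend ?J (list_boundary d (y # r)) = frag_of (y # r)"
      using "3.IH"(2) yce mem by simp
    have J: "?J (x # y # t) = - cons_frag x (?J (y # t))" for t
      using later by (simp add: interval_def)
    \<comment> \<open>All terms of \<open>?J (y # r)\<close> have the segment end of
      \<open>y # r\<close>, so y is smooth behind x in each of them.\<close>
    have "bd (cons_frag x (?J (y # r))) =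
       (if True then - frag_extend (\<lambda>L. frag_of (x # tl L)) (?J (y # r)) else 0) - cons_frag x (bd (?J (y # r)))"
    proof (intro boundary_cons_frag)
      fix L assume "L \<in> Poly_Mapping.keys (?J (y # r))"
      then have L: "pchain L" "y # r \<in> faces d L"
        using keys_insert_point[of "y # r" c] yce mem by auto
      then obtain w t where Lw: "L = y # w # t"
        by (auto elim: faces_Cons2_cases)
      have "sb x y w \<longleftrightarrow> sb x y (segment_end d L)"
        using sb_segment_end_iff L mem by (simp add: Lw)
      also have "segment_end d L = segment_end d (y # r)"
        using segment_end_faces L by simp
      also have "sb x y (segment_end d (y # r)) \<longleftrightarrow> sb x y z"
        using sb_segment_end_iff mem by (simp add: r)
      finally show "\<exists>y z r. L = y # z # r \<and> (sb x y z \<longleftrightarrow> True)"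
        using Lw xyz by auto
    qed
    \<comment> \<open>Removing y commutes with the insertion, because c fits between y and z iff it
      fits between x and z.\<close>
    moreover have "frag_extend (\<lambda>L. frag_of (x # tl L)) (?J (y # r)) = ?J (x # z # r')"
    proof -
      have "sb y c z \<longleftrightarrow> sb x c z"
        using xyc xyz sb_assoc[of x y z c] sb_assoc'[of x c z y] mem z by blast
      moreover have "frag_extend (\<lambda>L. frag_of (x # tl L)) (cons_frag y c') = cons_frag x c'" for c'
        unfolding frag_extend_cons_frag by (simp add: cons_frag_def)
      ultimately show ?thesis
        using mem by (simp add: r interval_def frag_extend_linear)
    qed
    moreover have "frag_extend (\<lambda>L. ?J (x # L)) (list_boundary d (y # r)) =
        - cons_frag x (frag_extend ?J (list_boundary d (y # r)))"
    proof -
      have "frag_extend (\<lambda>L. ?J (x # L)) (list_boundary d (y # r)) =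
          frag_extend (\<lambda>L. - cons_frag x (?J L)) (list_boundary d (y # r))"
        by (intro frag_extend_eq) (use keys_D J in force)
      then show ?thesis
        by (simp add: frag_extend_uminus_fun frag_extend_fun_cons_frag)
    qed
    moreover have "list_boundary d (x # y # r) = - frag_of (x # z # r') - cons_frag x (list_boundary d (y # r))"
      using xyz by (simp add: r)
    ultimately have "bd (?J (x # y # r)) + frag_extend ?J (list_boundary d (x # y # r)) =
        cons_frag x (bd (?J (y # r)) + frag_extend ?J (list_boundary d (y # r)))"
      by (simp add: J frag_extend_linear frag_extend_cons_frag del: insert_point.simps)
    then show ?thesis
      using IH by simp
  qed
qed (simp add: pchain_def)

end

section \<open>The contracting homotopy on chains that are not thin\<close>

context geodetic_no_cut
begin

lemma keys_contraction:
  assumes "pchain L" "L' \<in> Poly_Mapping.keys (contraction M d L)"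
  shows "pchain L' \<and> L \<in> faces d L'"
  using assms
proof (induction L arbitrary: L' rule: induct_list012)
  case (3 x y r)
  define I where "I = interval M d x (segment_end d (x # y # r))"
  show ?case
  proof (cases "I = {}")
    case True
    then have "L' \<in> Poly_Mapping.keys (cons_frag x (contraction M d (y # r)))"
      using "3.prems" by (simp add: I_def Let_def del: segment_end.simps)
    then obtain t where t: "L' = x # t" "t \<in> Poly_Mapping.keys (contraction M d (y # r))"
      using keys_cons_frag[of x "contraction M d (y # r)"] by blast
    then have IH: "pchain t" "y # r \<in> faces d t"
      using "3.IH"(2)[of t] "3.prems" by auto
    moreover obtain t' where "t = y # t'"
      using faces_Cons_cases[OF IH(2)] by auto
    ultimately show ?thesis
      using t "3.prems" faces_Cons by auto
  next
    case False
    then have "(SOME c. c \<in> I) \<in> I"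
      by (simp add: some_in_eq)
    moreover have "L' \<in> Poly_Mapping.keys (insert_point M d (SOME c. c \<in> I) (x # y # r))"
      using "3.prems" False by (simp add: I_def Let_def del: segment_end.simps insert_point.simps)
    ultimately show ?thesis
      using "3.prems"(1) by (intro keys_insert_point[of _ "SOME c. c \<in> I"]) (auto simp: I_def interval_def)
  qed
qed auto

text \<open>A face has the same first segment ends as the chain, so the same case of
  \<open>contraction\<close> applies to both. If the first interval is nonempty, this is
  \<open>insert_point_homotopy\<close> for one fixed c. Otherwise the second point is not smooth,
  and the identity is inherited from the tail.\<close>

lemma contraction_homotopy:
  assumes "pchain L" "\<not> thin M d L"
  shows "bd (contraction M d L) + frag_extend (contraction M d) (list_boundary d L) = frag_of L"
  using assms
proof (induction L rule: induct_list012)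
  case (3 x y r)
  let ?H = "contraction M d"
  let ?e = "segment_end d (x # y # r)"
  define I where "I = interval M d x ?e"
  have mem: "x \<in> M" "y \<in> M" "x \<noteq> y" "pchain (y # r)"
    using "3.prems" by (auto simp: pchain_def)
  have e: "?e \<in> M"
    using segment_end_in "3.prems" by blast
  show ?case
  proof (cases "I = {}")
    case False
    define c where "c = (SOME c. c \<in> I)"
    have "c \<in> I"
      using False by (simp add: c_def some_in_eq)
    have H: "?H (x # z # t) = insert_point M d c (x # z # t)"
      if "segment_end d (x # z # t) = ?e" for z t
      using that False by (simp add: I_def c_def Let_def del: segment_end.simps insert_point.simps)
    have "frag_extend ?H (list_boundary d (x # y # r)) =
        frag_extend (insert_point M d c) (list_boundary d (x # y # r))"
    proof (rule frag_extend_eq)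
      fix L assume "L \<in> Poly_Mapping.keys (list_boundary d (x # y # r))"
      then have L: "L \<in> faces d (x # y # r)"
        using keys_list_boundary by blast
      then obtain z t where "L = x # z # t"
        by (auto elim: faces_Cons2_cases)
      then show "?H L = insert_point M d c L"
        using H segment_end_faces[OF L "3.prems"(1)] by blast
    qed
    moreover have "?H (x # y # r) = insert_point M d c (x # y # r)"
      using H by blast
    moreover have "sb x c ?e" "c \<in> M"
      using \<open>c \<in> I\<close> by (auto simp: I_def interval_def)
    ultimately show ?thesis
      using insert_point_homotopy[of "x # y # r" c] "3.prems"(1) by simp
  next
    case True
    have H: "?H (x # z # t) = - cons_frag x (?H (z # t))"
      if "segment_end d (x # z # t) = ?e" for z t
      using that True by (simp add: I_def Let_def del: segment_end.simps)
    \<comment> \<open>Otherwise y itself would belong to the empty interval; so the first segment is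
      a single step.\<close>
    have "\<not> sb x y ?e"
      using True mem by (auto simp: I_def interval_def)
    then have ye: "y = ?e"
      using sb_segment_end "3.prems" by blast
    \<comment> \<open>The first step has an empty interval, so it is the tail that fails to be
      thin.\<close>
    then have tail_fat: "\<not> thin M d (y # r)"
      using "3.prems" True by (auto simp: I_def)
    then obtain z r' where r: "r = z # r'"
      by (cases r) auto
    have xyz: "\<not> sb x y z"
    proof
      assume xyz: "sb x y z"
      then have "sb x y (segment_end d (y # z # r'))"
        using sb_segment_end_iff mem by (simp add: r)
      then show False
        using xyz \<open>\<not> sb x y ?e\<close> by (simp add: r)
    qed
    \<comment> \<open>The contraction of the tail keeps its first segment end, so y stays non-smooth
      in every term and there is no correction.\<close>
    have "bd (cons_frag x (?H (y # r))) =
       (if False then - frag_extend (\<lambda>L. frag_of (x # tl L)) (?H (y # r)) else 0) - cons_frag x (bd (?H (y # r)))"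
    proof (intro boundary_cons_frag)
      fix L assume "L \<in> Poly_Mapping.keys (?H (y # r))"
      then have L: "pchain L" "y # r \<in> faces d L"
        using keys_contraction[of "y # r"] mem by auto
      then obtain w t where Lw: "L = y # w # t"
        by (auto elim: faces_Cons2_cases)
      have "sb x y w \<longleftrightarrow> sb x y (segment_end d L)"
        using sb_segment_end_iff L mem by (simp add: Lw)
      also have "segment_end d L = segment_end d (y # r)"
        using segment_end_faces L by simp
      also have "sb x y (segment_end d (y # r)) \<longleftrightarrow> sb x y z"
        using sb_segment_end_iff mem by (simp add: r)
      finally show "\<exists>y z r. L = y # z # r \<and> (sb x y z \<longleftrightarrow> False)"
        using Lw xyz by auto
    qed
    moreover have "frag_extend (\<lambda>L. ?H (x # L)) (list_boundary d (y # r)) =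
        - cons_frag x (frag_extend ?H (list_boundary d (y # r)))"
    proof -
      have "frag_extend (\<lambda>L. ?H (x # L)) (list_boundary d (y # r)) =
          frag_extend (\<lambda>L. - cons_frag x (?H L)) (list_boundary d (y # r))"
      proof (rule frag_extend_eq)
        fix L assume "L \<in> Poly_Mapping.keys (list_boundary d (y # r))"
        then have L: "L \<in> faces d (y # r)"
          using keys_list_boundary by blast
        then obtain t where "L = y # t"
          by (auto elim: faces_Cons_cases)
        then show "?H (x # L) = - cons_frag x (?H L)"
          using H segment_end_faces[OF faces_Cons[OF L] "3.prems"(1)] by blast
      qed
      then show ?thesis
        by (simp add: frag_extend_uminus_fun frag_extend_fun_cons_frag)
    qed
    moreover have "list_boundary d (x # y # r) = - cons_frag x (list_boundary d (y # r))"
      using xyz by (simp add: r)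
    moreover have "?H (x # y # r) = - cons_frag x (?H (y # r))"
      using H by blast
    ultimately have "bd (?H (x # y # r)) + frag_extend ?H (list_boundary d (x # y # r)) =
        cons_frag x (bd (?H (y # r)) + frag_extend ?H (list_boundary d (y # r)))"
      by (simp add: frag_extend_linear frag_extend_cons_frag del: contraction.simps)
    then show ?thesis
      using "3.IH"(2) tail_fat mem by simp
  qed
qed auto

end

subsection \<open>Nontrivial homology classes\<close>

context Metric_space
begin

lemma proper_chains_len_iff:
  "L \<in> proper_chains_len M d n l \<longleftrightarrow> length L = Suc n \<and> pchain L \<and> chain_length d L = l"
  by (auto simp: proper_chains_len_def proper_chains_iff pchain_def)

lemma faces_proper_chains_len:
  "L' \<in> faces d L \<Longrightarrow> L \<in> proper_chains_len M d (Suc n) l \<Longrightarrow> L' \<in> proper_chains_len M d n l"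
  using length_faces[of L' d L] faces_pchain chain_length_faces[of L' d L]
  by (auto simp: proper_chains_len_iff)

lemma keys_boundary_subset:
  "Poly_Mapping.keys (frag_extend (list_boundary d) c) \<subseteq> (\<Union>L\<in>Poly_Mapping.keys c. faces d L)"
  using keys_frag_extend[of "list_boundary d" c] keys_list_boundary by blast

lemma magnitude_boundary_carrier:
  assumes "c \<in> carrier (magnitude_chain_group M d n l)"
  shows "magnitude_boundary d n c = frag_extend (list_boundary d) c"
  using assms by (intro magnitude_boundary_eq)
    (auto simp: magnitude_chain_group_def proper_chains_len_iff)

lemma boundaries_subset_cycles: "magnitude_boundaries M d n l \<subseteq> magnitude_cycles M d n l"
proof
  fix c assume "c \<in> magnitude_boundaries M d n l"
  then obtain e where e: "e \<in> carrier (magnitude_chain_group M d (Suc n) l)"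
    and c: "c = frag_extend (list_boundary d) e"
    using magnitude_boundary_carrier by (auto simp: magnitude_boundaries_def)
  then have ke: "Poly_Mapping.keys e \<subseteq> proper_chains_len M d (Suc n) l"
    by (simp add: magnitude_chain_group_def)
  then have carr: "c \<in> carrier (magnitude_chain_group M d n l)"
    using keys_boundary_subset[of e] faces_proper_chains_len
    by (simp add: c magnitude_chain_group_def) blast
  have "frag_extend (list_boundary d) c = frag_extend (\<lambda>L. frag_extend (list_boundary d) (list_boundary d L)) e"
    by (simp add: c frag_extend_comp)
  also have "\<dots> = 0"
    by (intro frag_extend_eq_0 list_boundary_squared) (use ke in \<open>auto simp: proper_chains_len_iff\<close>)
  finally show "c \<in> magnitude_cycles M d n l"
    using carr magnitude_boundary_carrier[OF carr] by (simp add: magnitude_cycles_def)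
qed

text \<open>Later arguments use homology only through this criterion, which turns a statement on
  cosets into one on chains.\<close>

lemma trivial_magnitude_homology_iff:
  "trivial_group (magnitude_homology M d n l) \<longleftrightarrow> magnitude_cycles M d n l \<subseteq> magnitude_boundaries M d n l"
proof -
  let ?C = "magnitude_chain_group M d"
  let ?Z = "magnitude_cycles M d n l" and ?B = "magnitude_boundaries M d n l"
  have [simp]: "group (?C m l)" "comm_group (?C m l)" for m
    by (simp_all add: magnitude_chain_group_def abelian_free_Abelian_group)
  interpret C: comm_group "?C n l" by simp
  have Z: "subgroup ?Z (?C n l)"
  proof (rule C.subgroupI)
    show "?Z \<noteq> {}"
      by (auto simp: magnitude_cycles_def magnitude_chain_group_def magnitude_boundary_def intro!: exI[of _ 0])
  qed (use keys_add in \<open>force simp: magnitude_cycles_def magnitude_chain_group_def magnitude_boundary_def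
        frag_extend_minus frag_extend_add\<close>)+
  have B: "subgroup ?B (?C n l)"
  proof (rule C.subgroupI)
    show "?B \<subseteq> carrier (?C n l)"
      using boundaries_subset_cycles Z[THEN subgroup.subset] by blast
    have "0 \<in> carrier (?C (Suc n) l)"
      by (simp add: magnitude_chain_group_def)
    then show "?B \<noteq> {}"
      by (auto simp: magnitude_boundaries_def)
    show "inv\<^bsub>?C n l\<^esub> a \<in> ?B" if aB: "a \<in> ?B" for a
    proof -
      obtain e where e: "e \<in> carrier (?C (Suc n) l)" "a = magnitude_boundary d (Suc n) e"
        using aB unfolding magnitude_boundaries_def by blast
      have "a \<in> carrier (?C n l)"
        using aB \<open>?B \<subseteq> carrier (?C n l)\<close> by blast
      then have "inv\<^bsub>?C n l\<^esub> a = magnitude_boundary d (Suc n) (- e)"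
        by (simp add: e(2) magnitude_chain_group_def magnitude_boundary_def frag_extend_minus)
      moreover have "- e \<in> carrier (?C (Suc n) l)"
        using e by (simp add: magnitude_chain_group_def)
      ultimately show ?thesis
        by (simp add: magnitude_boundaries_def)
    qed
    show "a \<otimes>\<^bsub>?C n l\<^esub> b \<in> ?B" if abB: "a \<in> ?B" "b \<in> ?B" for a b
    proof -
      obtain e f where e: "e \<in> carrier (?C (Suc n) l)" "a = magnitude_boundary d (Suc n) e"
        and f: "f \<in> carrier (?C (Suc n) l)" "b = magnitude_boundary d (Suc n) f"
        using abB unfolding magnitude_boundaries_def by blast
      have "a \<otimes>\<^bsub>?C n l\<^esub> b = magnitude_boundary d (Suc n) (e + f)"
        by (simp add: e f magnitude_chain_group_def magnitude_boundary_def frag_extend_add)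
      moreover have "e + f \<in> carrier (?C (Suc n) l)"
        using e f keys_add[of e f] by (auto simp: magnitude_chain_group_def)
      ultimately show ?thesis
        by (simp add: magnitude_boundaries_def)
    qed
  qed
  define G where "G = subgroup_generated (?C n l) ?Z"
  have carrier_G: "carrier G = ?Z"
    using Z by (simp add: G_def subgroup.carrier_subgroup_generated_subgroup)
  interpret G: comm_group G
    unfolding G_def by (intro C.abelian_subgroup_generated C.comm_group_axioms)
  have "subgroup ?B G"
    unfolding G_def using B boundaries_subset_cycles by (intro C.subgroup_of_subgroup_generated)
  then interpret N: normal ?B G
    by (rule G.subgroup_imp_normal)
  interpret Q: group "G Mod ?B"
    by (rule N.factorgroup_is_group)
  have H: "magnitude_homology M d n l = G Mod ?B"
    by (simp add: magnitude_homology_def G_def)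
  have "trivial_group (G Mod ?B) \<longleftrightarrow> (\<forall>x\<in>carrier G. ?B #>\<^bsub>G\<^esub> x = ?B)"
    unfolding Q.trivial_group_subset by (auto simp: carrier_FactGroup)
  also have "\<dots> \<longleftrightarrow> (\<forall>x\<in>carrier G. x \<in> ?B)"
    using G.coset_join1[OF _ _ \<open>subgroup ?B G\<close>] G.coset_join2[OF _ \<open>subgroup ?B G\<close>] N.subset by blast
  finally show ?thesis
    by (auto simp: H carrier_G)
qed

text \<open>The removed point lies in the interval of the step that replaces it.\<close>

lemma faces_not_thin: "L \<in> faces d L' \<Longrightarrow> pchain L' \<Longrightarrow> \<not> thin M d L"
proof (induction L' arbitrary: L rule: induct_list012)
  case (3 x y s)
  then obtain z r where s: "s = z # r" by (cases s) auto
  have y: "y \<in> M"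
    using "3.prems" by (auto simp: pchain_def)
  show ?case
  proof (cases "L = x # z # r \<and> sb x y z")
    case True
    then show ?thesis using y by (auto simp: interval_def)
  next
    case False
    then obtain t where t: "L = x # t" "t \<in> faces d (y # s)"
      using "3.prems" by (auto simp: s split: if_splits)
    then obtain z' t' where "t = y # z' # t'"
      by (auto elim: faces_Cons2_cases)
    then show ?thesis
      using "3.IH"(2)[of t] t "3.prems" by simp
  qed
qed auto

text \<open>Boundaries are supported on faces of proper chains, and these are not thin. So L itself
  represents a nonzero class.\<close>

lemma nontrivial_homology_if_thin_cycle:
  assumes "L \<in> proper_chains_len M d n l" "thin M d L" "list_boundary d L = 0"
  shows "\<not> trivial_group (magnitude_homology M d n l)"
proof -
  have carr: "frag_of L \<in> carrier (magnitude_chain_group M d n l)"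
    using assms by (simp add: magnitude_chain_group_def)
  then have "frag_of L \<in> magnitude_cycles M d n l"
    using assms magnitude_boundary_carrier by (simp add: magnitude_cycles_def)
  moreover have "frag_of L \<notin> magnitude_boundaries M d n l"
  proof
    assume "frag_of L \<in> magnitude_boundaries M d n l"
    then obtain e where e: "e \<in> carrier (magnitude_chain_group M d (Suc n) l)"
      and L: "frag_of L = frag_extend (list_boundary d) e"
      using magnitude_boundary_carrier by (auto simp: magnitude_boundaries_def)
    obtain L' where L': "L' \<in> Poly_Mapping.keys e" "L \<in> faces d L'"
      using keys_boundary_subset[of e] by (auto simp: L[symmetric] keys_frag_of)
    then have "pchain L'"
      using e by (auto simp: magnitude_chain_group_def proper_chains_len_iff)
    then show False
      using faces_not_thin L' assms(2) by blast
  qed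
  ultimately show ?thesis
    using trivial_magnitude_homology_iff by blast
qed

end

section \<open>Alternating chains and lengths of thin chains\<close>

fun alternating :: "'a \<Rightarrow> 'a \<Rightarrow> nat \<Rightarrow> 'a list" where
  "alternating a b 0 = [a]"
| "alternating a b (Suc n) = a # alternating b a n"

lemma length_alternating [simp]: "length (alternating a b n) = Suc n"
  by (induction n arbitrary: a b) auto

context Metric_space
begin

lemma nontrivial_homology_if_gap:
  assumes "a \<in> M" "b \<in> M" "a \<noteq> b" "interval M d a b = {}"
  shows "\<not> trivial_group (magnitude_homology M d n (real n * d a b))"
proof (rule nontrivial_homology_if_thin_cycle)
  have ba: "interval M d b a = {}"
    using assms by (auto simp: interval_def strictly_between_def weakly_between_def commute add.commute)
  have alt: "\<exists>t. alternating x y m = x # t" for x y :: 'a and m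
    by (cases m) auto
  have no_return: "\<not> sb x y x" if "x \<in> M" "y \<in> M" for x y
    using sb_neq(1)[of x y x] that by blast
  \<comment> \<open>Both orders of a and b are treated at once, since the recursion of
    \<open>alternating\<close> swaps them. No point is smooth, because a point never lies strictly
    between another point and itself, so the boundary vanishes.\<close>
  have *: "pchain (alternating x y m) \<and> chain_length d (alternating x y m) = real m * d x y \<and>
      thin M d (alternating x y m) \<and> list_boundary d (alternating x y m) = 0"
    if "{x, y} = {a, b}" for x y m
    using that
  proof (induction m arbitrary: x y)
    case 0
    then show ?case using assms by (auto simp: doubleton_eq_iff)
  next
    case (Suc m)
    have xy: "x \<in> M" "y \<in> M" "x \<noteq> y" "interval M d x y = {}"
      using Suc.prems assms ba by (auto simp: doubleton_eq_iff)
    have IH: "pchain (alternating y x m)" "chain_length d (alternating y x m) = real m * d y x"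
      "thin M d (alternating y x m)" "list_boundary d (alternating y x m) = 0"
      using Suc.IH[of y x] Suc.prems by auto
    show ?case
    proof (cases m)
      case 0
      then show ?thesis using xy by simp
    next
      case (Suc j)
      obtain t where t: "alternating x y j = x # t"
        using alt by blast
      show ?thesis
        using IH xy no_return[of x y] commute[of x y] by (simp add: Suc t algebra_simps)
    qed
  qed
  then show "thin M d (alternating a b n)" "list_boundary d (alternating a b n) = 0"
    "alternating a b n \<in> proper_chains_len M d n (real n * d a b)"
    by (simp_all add: proper_chains_len_iff)
qed

text \<open>The first step serves as the witness: no step exceeds h, so a total of n h leaves it no
  choice but length h.\<close>

lemma thin_chain_length:
  assumes "\<And>a b. \<lbrakk>a \<in> M; b \<in> M; a \<noteq> b; interval M d a b = {}\<rbrakk> \<Longrightarrow> d a b \<le> h"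
  shows "\<lbrakk>pchain L; thin M d L; length L = Suc n\<rbrakk> \<Longrightarrow> chain_length d L \<le> real n * h \<and>
    (n > 0 \<longrightarrow> (\<exists>a\<in>M. \<exists>b\<in>M. a \<noteq> b \<and> interval M d a b = {} \<and> (chain_length d L = real n * h \<longrightarrow> d a b = h)))"
proof (induction L arbitrary: n rule: induct_list012)
  case (3 x y r)
  then obtain m where n: "n = Suc m" by (cases n) auto
  have xy: "x \<in> M" "y \<in> M" "x \<noteq> y" "interval M d x y = {}"
    using "3.prems" by (auto simp: pchain_def)
  have "chain_length d (y # r) \<le> real m * h"
    using "3.IH"(2)[of m] "3.prems" n by auto
  moreover have "d x y \<le> h"
    using assms xy by blast
  ultimately show ?case
    using xy by (intro conjI impI bexI[of _ x] bexI[of _ y]) (auto simp: n algebra_simps)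
qed auto

end

section \<open>Thin chains from nonvanishing homology\<close>

context geodetic_no_cut
begin

lemma thin_chain_if_nontrivial_homology:
  assumes "\<not> trivial_group (magnitude_homology M d n l)"
  obtains L where "L \<in> proper_chains_len M d n l" "thin M d L"
proof -
  obtain z where z: "z \<in> magnitude_cycles M d n l" "z \<notin> magnitude_boundaries M d n l"
    using assms trivial_magnitude_homology_iff by blast
  then have carr: "z \<in> carrier (magnitude_chain_group M d n l)" and bz: "bd z = 0"
    using magnitude_boundary_carrier by (auto simp: magnitude_cycles_def)
  then have keys_z: "Poly_Mapping.keys z \<subseteq> proper_chains_len M d n l"
    by (simp add: magnitude_chain_group_def)
  have "\<exists>L\<in>Poly_Mapping.keys z. thin M d L"
  proof (rule ccontr)
    assume fat: "\<not> (\<exists>L\<in>Poly_Mapping.keys z. thin M d L)"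
    let ?H = "frag_extend (contraction M d)"
    \<comment> \<open>The homotopy identity extends linearly to a cycle without thin terms. As
      \<open>bd z = 0\<close>, it exhibits z as the boundary of \<open>?H z\<close>.\<close>
    have "bd (?H z) + ?H (bd z) =
      frag_extend (\<lambda>L. bd (contraction M d L) + ?H (list_boundary d L)) z"
      by (simp add: frag_extend_linear)
    also have "\<dots> = frag_extend frag_of z"
      by (intro frag_extend_eq contraction_homotopy) (use keys_z fat in \<open>auto simp: proper_chains_len_iff\<close>)
    finally have zH: "z = bd (?H z)"
      by (simp add: bz frag_expansion[symmetric])
    \<comment> \<open>It remains to see that \<open>?H z\<close> is a chain of degree n + 1 in the
      same grading; this follows as each term of z is a face of the terms of its
      contraction.\<close>
    have "Poly_Mapping.keys (?H z) \<subseteq> proper_chains_len M d (Suc n) l"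
    proof
      fix L' assume "L' \<in> Poly_Mapping.keys (?H z)"
      then obtain L where L: "L \<in> Poly_Mapping.keys z" "L' \<in> Poly_Mapping.keys (contraction M d L)"
        using keys_frag_extend[of "contraction M d" z] by blast
      then have "pchain L'" "L \<in> faces d L'" "length L = Suc n" "chain_length d L = l"
        using keys_contraction[of L L'] keys_z by (auto simp: proper_chains_len_iff)
      then show "L' \<in> proper_chains_len M d (Suc n) l"
        using length_faces[of L d L'] chain_length_faces[of L d L'] by (simp add: proper_chains_len_iff)
    qed
    then have "?H z \<in> carrier (magnitude_chain_group M d (Suc n) l)"
      by (simp add: magnitude_chain_group_def)
    then have "z \<in> magnitude_boundaries M d n l"
      using zH magnitude_boundary_carrier unfolding magnitude_boundaries_def by (metis imageI)
    then show False
      using z by blast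
  qed
  then show ?thesis
    using that keys_z by blast
qed

end

section \<open>The vanishing threshold\<close>

theorem theorem5p7:
  fixes M :: "'a set" and d :: "'a \<Rightarrow> 'a \<Rightarrow> real" and k :: nat
  assumes "Metric_space M d"
    and "geodetic M d"
    and "\<nexists>x0 x1 x2 x3. four_cut M d x0 x1 x2 x3"
    and "gap_sup M d < \<infinity>"
    and "k > 0"
  shows "vanishing_threshold M d k = ereal (real k) * gap_sup M d \<and>
    (\<not> trivial_group (magnitude_homology M d k (real_of_ereal (vanishing_threshold M d k)))
     \<longleftrightarrow> (\<exists>a\<in>M. \<exists>b\<in>M. a \<noteq> b \<and> ereal (d a b) = gap_sup M d \<and> interval M d a b = {}))"
proof -
  interpret geodetic_no_cut M d
    using assms by (auto simp: geodetic_no_cut_def geodetic_no_cut_axioms_def)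
  let ?gap = "\<lambda>a b. a \<in> M \<and> b \<in> M \<and> a \<noteq> b \<and> interval M d a b = {}"
  have gap_le: "ereal (d a b) \<le> gap_sup M d" if "?gap a b" for a b
    using that by (auto simp: gap_sup_def gap_distances_def intro!: Sup_upper)
  obtain h where h: "gap_sup M d = ereal h"
  proof (cases "gap_sup M d")
    \<comment> \<open>With no gap the supremum is 0 by convention; otherwise it is at least a real
      distance. So minus infinity is impossible.\<close>
    case MInf
    then have "gap_distances M d \<noteq> {}"
      by (auto simp: gap_sup_def)
    then show ?thesis
      using gap_le MInf by (force simp: gap_distances_def)
  qed (use assms(4) in auto)
  have d_le: "d a b \<le> h" if "a \<in> M" "b \<in> M" "a \<noteq> b" "interval M d a b = {}" for a b
    using gap_le[of a b] that by (simp add: h)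
  have nontrivial: "l \<le> real k * h \<and> (\<exists>a b. ?gap a b \<and> (l = real k * h \<longrightarrow> d a b = h))"
    if "\<not> trivial_group (magnitude_homology M d k l)" for l
  proof -
    obtain L where "L \<in> proper_chains_len M d k l" "thin M d L"
      using thin_chain_if_nontrivial_homology \<open>\<not> trivial_group _\<close> by blast
    then show ?thesis
      using thin_chain_length[OF d_le, of L k] \<open>k > 0\<close> unfolding proper_chains_len_iff by blast
  qed
  have "vanishing_threshold M d k = ereal (real k * h)"
  proof (cases "gap_distances M d = {}")
    case True
    \<comment> \<open>Any nonvanishing grading would produce a gap. Thus both sides of the claim
      take their default value 0.\<close>
    then have "nonvanishing_gradings M d k = {}"
      using nontrivial by (fastforce simp: gap_distances_def nonvanishing_gradings_def)
    moreover have "h = 0"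
      using h True by (simp add: gap_sup_def)
    ultimately show ?thesis
      by (simp add: vanishing_threshold_def)
  next
    case False
    have attained: "ereal (real k * d a b) \<in> nonvanishing_gradings M d k" if "?gap a b" for a b
      using nontrivial_homology_if_gap[of a b k] that \<open>k > 0\<close> mdist_pos_less[of a b]
      unfolding nonvanishing_gradings_def by auto
    then have ne: "nonvanishing_gradings M d k \<noteq> {}"
      using False by (auto simp: gap_distances_def)
    have "Sup (nonvanishing_gradings M d k) = ereal (real k * h)"
    proof (rule Sup_eqI)
      show "y \<le> ereal (real k * h)" if "y \<in> nonvanishing_gradings M d k" for y
        using that nontrivial by (auto simp: nonvanishing_gradings_def)
      fix u assume u: "\<And>y. y \<in> nonvanishing_gradings M d k \<Longrightarrow> y \<le> u"
      show "ereal (real k * h) \<le> u"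
      proof (cases u)
        case (real v)
        \<comment> \<open>Each gap contributes the grading k d(a,b), so an upper bound v of the
          gradings bounds all gaps by v / k. Among infinite u, only minus infinity needs an
          argument; it is excluded as some grading occurs.\<close>
        have "Sup (gap_distances M d) \<le> ereal (v / real k)"
        proof (rule Sup_least)
          fix y assume "y \<in> gap_distances M d"
          then obtain a b where "y = ereal (d a b)" "?gap a b"
            by (auto simp: gap_distances_def)
          then show "y \<le> ereal (v / real k)"
            using u[OF attained, of a b] \<open>k > 0\<close> by (simp add: real field_simps)
        qed
        then show ?thesis
          using h False \<open>k > 0\<close> by (simp add: gap_sup_def real field_simps)
      qed (use u ne in \<open>force simp: nonvanishing_gradings_def\<close>)+
    qed
    then show ?thesis
      using ne by (simp add: vanishing_threshold_def)
  qed
  \<comment> \<open>The fact \<open>nontrivial\<close> is not restricted to positive gradings, so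
    the case k h = 0 is included.\<close>
  moreover have "\<not> trivial_group (magnitude_homology M d k (real k * h)) \<longleftrightarrow> (\<exists>a b. ?gap a b \<and> d a b = h)"
    using nontrivial[of "real k * h"] nontrivial_homology_if_gap[of _ _ k] by metis
  ultimately show ?thesis
    by (auto simp: h)
qed

end
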